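(* Let $G=N\rtimes H$, $M$, $\mathcal U$, $D$, $\alpha$, $\overline N$ and $\bar\alpha$ be as in the context. If $\mathcal U$ has finite quotients, i.e. $|U/V|<\infty$ whenever $U,V\in\mathcal U$ and $V\subseteq U$, then the restriction map $\rho$ of $C_0(\overline N)$ into $\ell^\infty(N)$ given by $\rho(f)=f|_N$ is an $\bar\alpha$–$\alpha$ equivariant isomorphism of $C_0(\overline N)$ onto $D$.
   Context: $G=N\rtimes H$ is a discrete group which is a semidirect product with normal subgroup $N$ and quotient group $H$ (regarded as a subgroup of $G$, acting on $N$ by conjugation), and $M\neq\{e\}$ is a normal subgroup of $N$. Put $\mathcal U=\{aMa^{-1}:a\in H\}$, a family of normal subgroups of $N$. Standing assumptions: (filter base) for all $U,V\in\mathcal U$ there is $W\in\mathcal U$ with $W\subseteq U\cap V$; (separating) $\bigcap_{U\in\mathcal U}U=\{e\}$. For $g=xa\in G$ with $x\in N$, $a\in H$, let $\beta_g:N\to N$ be the bijection $\beta_g(y)=xaya^{-1}$; $g\mapsto\beta_g$ is an action of $G$ on the set $N$. Let $\alpha$ be the action of $G$ on $\ell^\infty(N)$ given by $\alpha_g(f)=f\circ\beta_{g^{-1}}$. The set $\mathcal P=\{\chi_{xU}:x\in N,U\in\mathcal U\}\subseteq\ell^\infty(N)$ is $\alpha$-invariant, and $D=C^*(\mathcal P)$ is the $C^*$-subalgebra of $\ell^\infty(N)$ generated by $\mathcal P$; $\alpha$ restricts to an action of $G$ on $D$, also denoted $\alpha$. $N$ carries the group topology having $\mathcal U$ as a neighborhood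 base at $e$ (the subgroup topology), and $\overline N=\varprojlim_{U\in\mathcal U}N/U$ is its Hausdorff completion, in which $N$ is a dense subgroup. Each $\beta_g$ is a uniform isomorphism of $N$ and so extends uniquely to a homeomorphism $\bar\beta_g$ of $\overline N$; this gives an action $\bar\beta$ of $G$ on $\overline N$, and $\bar\alpha_g(f)=f\circ\bar\beta_{g^{-1}}$ for $f\in C_0(\overline N)$. ($\overline N$ is locally compact when $\mathcal U$ has finite quotients.) *)

theory Defs
  imports "HOL-Analysis.Analysis" "HOL-Algebra.Coset"
begin

text \<open>
  A complex function on a set \<open>X\<close> is represented by a total function that is 0 outside \<open>X\<close>,
  so that the algebra operations on function spaces are the pointwise ones.
\<close>

definition linf :: "'x set \<Rightarrow> ('x \<Rightarrow> complex) set" where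
  "linf X = {f. (\<forall>x. x \<notin> X \<longrightarrow> f x = 0) \<and> bounded (f ` X)}"

definition sup_norm :: "'x set \<Rightarrow> ('x \<Rightarrow> complex) \<Rightarrow> real" where
  "sup_norm X f = (SUP x\<in>X. norm (f x))"

definition cstar_subalgebra :: "'x set \<Rightarrow> ('x \<Rightarrow> complex) set \<Rightarrow> bool" where
  "cstar_subalgebra X A \<longleftrightarrow>
     A \<subseteq> linf X \<and>
     (\<lambda>x. 0) \<in> A \<and>
     (\<forall>f\<in>A. \<forall>h\<in>A. (\<lambda>x. f x + h x) \<in> A) \<and>
     (\<forall>c. \<forall>f\<in>A. (\<lambda>x. c * f x) \<in> A) \<and>
     (\<forall>f\<in>A. \<forall>h\<in>A. (\<lambda>x. f x * h x) \<in> A) \<and>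
     (\<forall>f\<in>A. (\<lambda>x. cnj (f x)) \<in> A) \<and>
     (\<forall>f\<in>linf X. (\<forall>e>0. \<exists>h\<in>A. sup_norm X (\<lambda>x. f x - h x) < e) \<longrightarrow> f \<in> A)"

definition cstar_generated :: "'x set \<Rightarrow> ('x \<Rightarrow> complex) set \<Rightarrow> ('x \<Rightarrow> complex) set" where
  "cstar_generated X P = \<Inter>{A. cstar_subalgebra X A \<and> P \<subseteq> A}"

definition C0 :: "'x topology \<Rightarrow> ('x \<Rightarrow> complex) set" where
  "C0 X = {f. continuous_map X euclidean f \<and>
              (\<forall>x. x \<notin> topspace X \<longrightarrow> f x = 0) \<and>
              (\<forall>e>0. compactin X {x \<in> topspace X. e \<le> norm (f x)})}"

definition star_isomorphism ::
  "('x \<Rightarrow> complex) set \<Rightarrow> ('y \<Rightarrow> complex) set \<Rightarrow> (('x \<Rightarrow> complex) \<Rightarrow> ('y \<Rightarrow> complex)) \<Rightarrow> bool" where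
  "star_isomorphism A B \<phi> \<longleftrightarrow>
     bij_betw \<phi> A B \<and>
     (\<forall>f\<in>A. \<forall>h\<in>A. \<phi> (\<lambda>x. f x + h x) = (\<lambda>y. \<phi> f y + \<phi> h y)) \<and>
     (\<forall>c. \<forall>f\<in>A. \<phi> (\<lambda>x. c * f x) = (\<lambda>y. c * \<phi> f y)) \<and>
     (\<forall>f\<in>A. \<forall>h\<in>A. \<phi> (\<lambda>x. f x * h x) = (\<lambda>y. \<phi> f y * \<phi> h y)) \<and>
     (\<forall>f\<in>A. \<phi> (\<lambda>x. cnj (f x)) = (\<lambda>y. cnj (\<phi> f y)))"

definition conjugates :: "('a, 'b) monoid_scheme \<Rightarrow> 'a set \<Rightarrow> 'a set \<Rightarrow> 'a set set" where
  "conjugates G H M = (\<lambda>a. (\<lambda>m. a \<otimes>\<^bsub>G\<^esub> m \<otimes>\<^bsub>G\<^esub> inv\<^bsub>G\<^esub> a) ` M) ` H"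

text \<open>
  \<open>g = x a\<close> with \<open>x \<in> N\<close>, \<open>a \<in> H\<close> is a unique decomposition when \<open>G\<close> is the semidirect product
  of \<open>N\<close> and \<open>H\<close>.
\<close>

definition \<beta> ::
  "('a, 'b) monoid_scheme \<Rightarrow> 'a set \<Rightarrow> 'a set \<Rightarrow> 'a \<Rightarrow> 'a \<Rightarrow> 'a" where
  "\<beta> G N H g y =
     (THE z. \<exists>x\<in>N. \<exists>a\<in>H. g = x \<otimes>\<^bsub>G\<^esub> a \<and> z = x \<otimes>\<^bsub>G\<^esub> a \<otimes>\<^bsub>G\<^esub> y \<otimes>\<^bsub>G\<^esub> inv\<^bsub>G\<^esub> a)"

definition \<alpha> ::
  "('a, 'b) monoid_scheme \<Rightarrow> 'a set \<Rightarrow> 'a set \<Rightarrow> 'a \<Rightarrow> ('a \<Rightarrow> complex) \<Rightarrow> ('a \<Rightarrow> complex)" where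
  "\<alpha> G N H g f = (\<lambda>y. if y \<in> N then f (\<beta> G N H (inv\<^bsub>G\<^esub> g) y) else 0)"

definition coset_algebra ::
  "('a, 'b) monoid_scheme \<Rightarrow> 'a set \<Rightarrow> 'a set set \<Rightarrow> ('a \<Rightarrow> complex) set" where
  "coset_algebra G N \<U> = cstar_generated N {indicator (x <#\<^bsub>G\<^esub> U) |x U. x \<in> N \<and> U \<in> \<U>}"

text \<open>
  The inverse limit of the discrete quotients \<open>N/U\<close>; the connecting map \<open>N/V \<rightarrow> N/U\<close> for
  \<open>V \<subseteq> U\<close> sends a coset \<open>C\<close> to \<open>C U\<close>.
\<close>

definition group_completion ::
  "('a, 'b) monoid_scheme \<Rightarrow> 'a set \<Rightarrow> 'a set set \<Rightarrow> ('a set \<Rightarrow> 'a set) topology" where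
  "group_completion G N \<U> =
     subtopology
       (product_topology (\<lambda>U. discrete_topology (carrier (G\<lparr>carrier := N\<rparr> Mod U))) \<U>)
       {z. \<forall>U\<in>\<U>. \<forall>V\<in>\<U>. V \<subseteq> U \<longrightarrow> z V <#>\<^bsub>G\<^esub> U = z U}"

definition coset_embed ::
  "('a, 'b) monoid_scheme \<Rightarrow> 'a set set \<Rightarrow> 'a \<Rightarrow> ('a set \<Rightarrow> 'a set)" where
  "coset_embed G \<U> x = (\<lambda>U\<in>\<U>. x <#\<^bsub>G\<^esub> U)"

text \<open>
  The unique homeomorphism of the completion that extends \<open>\<beta> G N H g\<close>; being extensional
  only fixes its irrelevant values outside the completion.
\<close>

definition \<beta>_bar ::
  "('a, 'b) monoid_scheme \<Rightarrow> 'a set \<Rightarrow> 'a set \<Rightarrow> 'a set set \<Rightarrow> 'a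
     \<Rightarrow> ('a set \<Rightarrow> 'a set) \<Rightarrow> ('a set \<Rightarrow> 'a set)" where
  "\<beta>_bar G N H \<U> g =
     (THE h. h \<in> extensional (topspace (group_completion G N \<U>)) \<and>
             homeomorphic_map (group_completion G N \<U>) (group_completion G N \<U>) h \<and>
             (\<forall>y\<in>N. h (coset_embed G \<U> y) = coset_embed G \<U> (\<beta> G N H g y)))"

definition \<alpha>_bar ::
  "('a, 'b) monoid_scheme \<Rightarrow> 'a set \<Rightarrow> 'a set \<Rightarrow> 'a set set \<Rightarrow> 'a
     \<Rightarrow> (('a set \<Rightarrow> 'a set) \<Rightarrow> complex) \<Rightarrow> (('a set \<Rightarrow> 'a set) \<Rightarrow> complex)" where
  "\<alpha>_bar G N H \<U> g f =
     (\<lambda>z. if z \<in> topspace (group_completion G N \<U>) then f (\<beta>_bar G N H \<U> (inv\<^bsub>G\<^esub> g) z) else 0)"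

text \<open>Restriction to \<open>N\<close>, regarded as a subset of the completion through \<open>coset_embed\<close>.\<close>

definition restriction ::
  "('a, 'b) monoid_scheme \<Rightarrow> 'a set \<Rightarrow> 'a set set
     \<Rightarrow> (('a set \<Rightarrow> 'a set) \<Rightarrow> complex) \<Rightarrow> ('a \<Rightarrow> complex)" where
  "restriction G N \<U> f = (\<lambda>x. if x \<in> N then f (coset_embed G \<U> x) else 0)"

end

theory Submission imports Defs begin

text \<open>
  The points of the completion \<open>X\<close> are compatible families of cosets. Since the family \<open>\<U>\<close> is
  directed, the cylinders, consisting of the points with a prescribed coset at one coordinate
  \<open>U\<close>, form a base of clopen sets (\<open>cylinder_base\<close>); every nonempty cylinder meets \<open>N\<close>, so \<open>N\<close> is
  dense (\<open>dense_embed\<close>). By density restriction to \<open>N\<close> is injective on \<open>C0 X\<close> and isometric, and as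
  \<open>C0 X\<close> is complete, its image is a \<open>C\<^sup>*\<close>-subalgebra of \<open>linf N\<close>
  (\<open>cstar_subalgebra_restriction_image\<close>).

  It remains to see that the image is generated by the indicators of cosets. These indicators are
  the restrictions of the indicators of cylinders, so they belong to the image as soon as cylinders
  are compact. This is where finiteness of the quotients enters: a cylinder is a closed subset of a
  product of finite sets (\<open>compactin_cylinder\<close>). Conversely, a function in \<open>C0 X\<close> is uniformly close
  to a finite combination of indicators of cylinders, because on a compact set it varies little over
  the cosets of a suitable \<open>V\<close> (\<open>restriction_in_cstar_subalgebra\<close>).

  For equivariance, \<open>\<beta> G N H g\<close> is uniformly continuous with uniformly continuous inverse
  \<open>\<beta> G N H (inv g)\<close>, since conjugation by \<open>H\<close> permutes \<open>\<U>\<close>. Hence it extends uniquely to a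
  homeomorphism of \<open>X\<close> (\<open>ex1_homeomorphic_extension\<close>), which makes the description that defines
  \<open>\<beta>_bar\<close> meaningful; on \<open>N\<close> the two actions then agree by construction.
\<close>


section \<open>Functions vanishing at infinity\<close>

lemma C0_continuous: "f \<in> C0 X \<Longrightarrow> continuous_map X euclidean f"
  and C0_outside: "f \<in> C0 X \<Longrightarrow> x \<notin> topspace X \<Longrightarrow> f x = 0"
  and C0_compact: "f \<in> C0 X \<Longrightarrow> e > 0 \<Longrightarrow> compactin X {x \<in> topspace X. e \<le> norm (f x)}"
  by (auto simp: C0_def)

text \<open>
  The set on which \<open>norm f\<close> is at least \<open>e\<close> is closed, so it is enough to enclose it in a
  compact set; this spares the topological bookkeeping in every later membership proof.
\<close>

lemma C0_I:
  assumes f: "continuous_map X euclidean f" and 0: "\<And>x. x \<notin> topspace X \<Longrightarrow> f x = 0"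
    and K: "\<And>e. e > 0 \<Longrightarrow> \<exists>K. compactin X K \<and> (\<forall>x\<in>topspace X. e \<le> norm (f x) \<longrightarrow> x \<in> K)"
  shows "f \<in> C0 X"
proof -
  have "compactin X {x \<in> topspace X. e \<le> norm (f x)}" if "e > 0" for e
  proof -
    obtain K where "compactin X K" "\<forall>x\<in>topspace X. e \<le> norm (f x) \<longrightarrow> x \<in> K"
      using K \<open>e > 0\<close> by blast
    moreover have "closedin X {x \<in> topspace X. f x \<in> {z. e \<le> norm z}}"
      by (rule closedin_continuous_map_preimage[OF f])
        (auto intro!: closed_Collect_le continuous_intros)
    ultimately show ?thesis
      using closed_compactin[of X K "{x \<in> topspace X. e \<le> norm (f x)}"] by auto
  qed
  then show ?thesis using f 0 by (auto simp: C0_def)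
qed

lemma C0_bounded:
  assumes "f \<in> C0 X"
  obtains B where "B > 0" "\<And>x. norm (f x) \<le> B"
proof -
  have "compactin euclidean (f ` {x \<in> topspace X. 1 \<le> norm (f x)})"
    using image_compactin[OF C0_compact[OF assms, of 1] C0_continuous[OF assms]] by simp
  then have "bounded (f ` {x \<in> topspace X. 1 \<le> norm (f x)})"
    by (simp add: compact_imp_bounded)
  then obtain B where B: "\<forall>x\<in>topspace X. 1 \<le> norm (f x) \<longrightarrow> norm (f x) \<le> B"
    by (auto simp: bounded_iff)
  have "norm (f x) \<le> max 1 B" for x
    using B C0_outside[OF assms, of x] by (cases "x \<in> topspace X") fastforce+
  then show ?thesis using that[of "max 1 B"] by simp
qed

lemma C0_zero: "(\<lambda>x. 0) \<in> C0 X"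
  by (auto simp: C0_def not_le)

lemma C0_add:
  assumes "f \<in> C0 X" "h \<in> C0 X"
  shows "(\<lambda>x. f x + h x) \<in> C0 X"
proof (rule C0_I)
  fix e :: real assume "e > 0"
  let ?K = "{x \<in> topspace X. e/2 \<le> norm (f x)} \<union> {x \<in> topspace X. e/2 \<le> norm (h x)}"
  have "compactin X ?K"
    using \<open>e > 0\<close> assms by (intro compactin_Un C0_compact) auto
  moreover have "e/2 \<le> norm (f x) \<or> e/2 \<le> norm (h x)" if "e \<le> norm (f x + h x)" for x
    using that norm_triangle_ineq[of "f x" "h x"] by linarith
  ultimately show "\<exists>K. compactin X K \<and> (\<forall>x\<in>topspace X. e \<le> norm (f x + h x) \<longrightarrow> x \<in> K)"
    by (intro exI[of _ ?K]) auto
qed (use assms in \<open>auto intro!: continuous_intros simp: C0_continuous C0_outside\<close>)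

text \<open>
  Products, scalar multiples and conjugates all lie in \<open>C0 X\<close> for this one reason: their norm is
  dominated by a constant multiple of a function that vanishes at infinity.
\<close>

lemma C0_dominated:
  assumes f: "f \<in> C0 X" and h: "continuous_map X euclidean h"
    and B: "B > 0" "\<And>x. norm (h x) \<le> B * norm (f x)"
  shows "h \<in> C0 X"
proof (rule C0_I[OF h])
  show "h x = 0" if "x \<notin> topspace X" for x
    using B(2)[of x] C0_outside[OF f that] by simp
  fix e :: real assume "e > 0"
  have "e / B \<le> norm (f x)" if "e \<le> norm (h x)" for x
    using order_trans[OF that B(2)] B(1) by (simp add: field_simps)
  then show "\<exists>K. compactin X K \<and> (\<forall>x\<in>topspace X. e \<le> norm (h x) \<longrightarrow> x \<in> K)"
    using C0_compact[OF f, of "e / B"] \<open>e > 0\<close> B(1)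
    by (intro exI[of _ "{x \<in> topspace X. e / B \<le> norm (f x)}"]) auto
qed

lemma continuous_map_complex_mult:
  fixes f h :: "'x \<Rightarrow> complex"
  shows "continuous_map X euclidean f \<Longrightarrow> continuous_map X euclidean h
    \<Longrightarrow> continuous_map X euclidean (\<lambda>x. f x * h x)"
  by (simp add: continuous_map_atin tendsto_mult)

lemma C0_mult:
  assumes "f \<in> C0 X" "h \<in> C0 X"
  shows "(\<lambda>x. f x * h x) \<in> C0 X"
proof -
  obtain B where "B > 0" "\<And>x. norm (f x) \<le> B"
    using C0_bounded[OF assms(1)] by blast
  then show ?thesis using assms
    by (intro C0_dominated[OF assms(2), of _ B])
      (auto intro!: continuous_map_complex_mult mult_right_mono simp: C0_continuous norm_mult)
qed

lemma C0_scale: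
  assumes "f \<in> C0 X"
  shows "(\<lambda>x. c * f x) \<in> C0 X"
  by (rule C0_dominated[OF assms, of _ "norm c + 1"])
    (auto intro!: continuous_map_complex_mult mult_right_mono C0_continuous[OF assms]
      simp: norm_mult add_nonneg_pos)

lemma C0_cnj:
  assumes "f \<in> C0 X"
  shows "(\<lambda>x. cnj (f x)) \<in> C0 X"
proof (rule C0_dominated[OF assms, of _ 1])
  have "continuous_map X euclidean (cnj \<circ> f)"
    using C0_continuous[OF assms]
    by (rule continuous_map_compose) (simp add: continuous_on_cnj)
  then show "continuous_map X euclidean (\<lambda>x. cnj (f x))" by (simp add: o_def)
qed auto

lemma C0_diff:
  assumes "f \<in> C0 X" "h \<in> C0 X"
  shows "(\<lambda>x. f x - h x) \<in> C0 X"
  using C0_add[OF assms(1) C0_scale[OF assms(2), of "-1"]] by simp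

lemma C0_indicator:
  assumes "openin X K" "compactin X K" "closedin X K"
  shows "indicator K \<in> C0 X"
proof (rule C0_I)
  show "continuous_map X euclidean (indicator K :: _ \<Rightarrow> complex)"
    unfolding continuous_map_def
  proof (intro conjI allI impI)
    fix S :: "complex set" 
    have "openin X (topspace X - K)"
      using assms(3) by blast
    moreover have "{x \<in> topspace X. indicator K x \<in> S} =
        (if 1 \<in> S then K else {}) \<union> (if 0 \<in> S then topspace X - K else {})"
      using openin_subset[OF assms(1)] by (auto simp: indicator_def split: if_splits)
    ultimately show "openin X {x \<in> topspace X. indicator K x \<in> S}"
      using assms(1) by auto
  qed auto
  show "indicator K x = 0" if "x \<notin> topspace X" for x
    using that openin_subset[OF assms(1)] by (auto simp: indicator_def)
  fix e :: real assume "e > 0"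
  then show "\<exists>C. compactin X C \<and> (\<forall>x\<in>topspace X. e \<le> norm (indicator K x :: complex) \<longrightarrow> x \<in> C)"
    by (intro exI[of _ K]) (auto simp: assms(2) indicator_def)
qed

text \<open>
  Completeness of \<open>C0 X\<close>. The limit vanishes at infinity because it is within \<open>e/2\<close> of some
  \<open>F n\<close>, hence exceeds \<open>e\<close> only where \<open>F n\<close> exceeds \<open>e/2\<close>.
\<close>

lemma C0_uniform_limit:
  fixes F :: "nat \<Rightarrow> 'x \<Rightarrow> complex"
  assumes F: "\<And>n. F n \<in> C0 X"
    and Cauchy: "\<And>e. e > 0 \<Longrightarrow>
      \<exists>k. \<forall>m n x. k \<le> m \<longrightarrow> k \<le> n \<longrightarrow> x \<in> topspace X \<longrightarrow> dist (F m x) (F n x) < e"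
  obtains f where "f \<in> C0 X"
    "\<And>e. e > 0 \<Longrightarrow> \<forall>\<^sub>F n in sequentially. \<forall>x\<in>topspace X. dist (F n x) (f x) < e"
proof -
  obtain g where g: "continuous_map X euclidean g"
    and lim: "\<And>e. e > 0 \<Longrightarrow> \<forall>\<^sub>F n in sequentially. \<forall>x\<in>topspace X. dist (F n x) (g x) < e"
  proof (rule Met_TC.continuous_map_uniformly_Cauchy_limit[of X F])
    show "Met_TC.mcomplete TYPE(complex)"
      by (simp add: complete_UNIV)
  qed (use F Cauchy in \<open>auto simp: C0_continuous\<close>)
  define f where "f = (\<lambda>x. if x \<in> topspace X then g x else 0)"
  have "f \<in> C0 X"
  proof (rule C0_I)
    show "continuous_map X euclidean f"
      using g by (rule continuous_map_eq) (simp add: f_def)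
    show "f x = 0" if "x \<notin> topspace X" for x
      using that by (simp add: f_def)
    fix e :: real assume "e > 0"
    then obtain n where n: "\<forall>x\<in>topspace X. dist (F n x) (g x) < e/2"
      using eventually_happens[OF lim[of "e/2"]] by auto
    have "e/2 \<le> norm (F n x)" if "x \<in> topspace X" "e \<le> norm (f x)" for x
      using n that norm_triangle_ineq2[of "g x" "F n x"]
      by (fastforce simp: f_def dist_norm norm_minus_commute)
    then show "\<exists>K. compactin X K \<and> (\<forall>x\<in>topspace X. e \<le> norm (f x) \<longrightarrow> x \<in> K)"
      using C0_compact[OF F, of "e/2" n] \<open>e > 0\<close>
      by (intro exI[of _ "{x \<in> topspace X. e/2 \<le> norm (F n x)}"]) auto
  qed
  then show ?thesis
    by (rule that) (use lim in \<open>simp add: f_def\<close>)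
qed

lemma norm_le_on_closure:
  fixes f :: "'x \<Rightarrow> complex"
  assumes f: "continuous_map X euclidean f" and S: "\<And>x. x \<in> S \<Longrightarrow> norm (f x) \<le> c"
    and x: "x \<in> X closure_of S"
  shows "norm (f x) \<le> c"
proof -
  have "f x \<in> closure (f ` S)"
    using continuous_map_image_closure_subset[OF f, of S] x by auto
  moreover have "closure (f ` S) \<subseteq> cball 0 c"
    using S by (intro closure_minimal) auto
  ultimately show ?thesis by auto
qed

lemma norm_less_if_sup_norm_less:
  assumes "bounded (f ` X)" "sup_norm X f < e" "x \<in> X"
  shows "norm (f x) < e"
proof -
  have "bdd_above ((\<lambda>x. norm (f x)) ` X)"
    using assms(1) by (auto simp: bounded_iff bdd_above_def)
  then have "norm (f x) \<le> sup_norm X f"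
    unfolding sup_norm_def using assms(3) by (rule cSUP_upper2) simp
  then show ?thesis using assms(2) by simp
qed

section \<open>Directed families of normal subgroups\<close>

text \<open>
  A family of normal subgroups as here is a neighborhood base at the identity of a group topology
  on \<open>N\<close>, whose basic open sets are the cosets of the members of \<open>\<U>\<close>. Left cosets are used
  throughout; by normality they are also the elements of the quotients.
\<close>

locale subgroup_topology = group G for G (structure) +
  fixes N :: "'a set" and \<U> :: "'a set set"
  assumes N: "subgroup N G"
    and normal: "\<And>U. U \<in> \<U> \<Longrightarrow> U \<lhd> G\<lparr>carrier := N\<rparr>"
    and nonempty: "\<U> \<noteq> {}"
    and directed: "\<And>U V. U \<in> \<U> \<Longrightarrow> V \<in> \<U> \<Longrightarrow> \<exists>W\<in>\<U>. W \<subseteq> U \<inter> V"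
begin

lemma N_carrier: "x \<in> N \<Longrightarrow> x \<in> carrier G"
  using subgroup.mem_carrier[OF N] .

lemma subgroup_U: 
  assumes "U \<in> \<U>"
  shows "subgroup U G" "U \<subseteq> N"
proof -
  interpret n: normal U "G\<lparr>carrier := N\<rparr>" by (rule normal[OF assms])
  show "U \<subseteq> N" using n.subset by simp
  show "subgroup U G" by (rule incl_subgroup[OF N n.subgroup_axioms])
qed

lemma directed_finite:
  assumes "finite F" "F \<subseteq> \<U>"
  shows "\<exists>W\<in>\<U>. \<forall>U\<in>F. W \<subseteq> U"
  using assms
proof (induction F rule: finite_induct)
  case empty
  then show ?case using nonempty by auto
next
  case (insert U F)
  then obtain W where W: "W \<in> \<U>" "\<forall>U\<in>F. W \<subseteq> U" by auto
  with insert.prems obtain W' where "W' \<in> \<U>" "W' \<subseteq> U \<inter> W"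
    using directed[of U W] by auto
  with W show ?case by (intro bexI[of _ W']) auto
qed

lemma coset_eq_iff:
  assumes "U \<in> \<U>" "x \<in> N" "y \<in> N"
  shows "x <# U = y <# U \<longleftrightarrow> y \<in> x <# U"
proof
  have "y \<otimes> \<one> \<in> y <# U"
    using subgroup.one_closed[OF subgroup_U(1)[OF assms(1)]] unfolding l_coset_def by blast
  then show "y \<in> x <# U" if "x <# U = y <# U"
    using that N_carrier[OF assms(3)] by simp
  show "x <# U = y <# U" if "y \<in> x <# U"
    using l_repr_independence[OF that N_carrier[OF assms(2)] subgroup_U(1)[OF assms(1)]] .
qed

lemma coset_self: "U \<in> \<U> \<Longrightarrow> x \<in> N \<Longrightarrow> x \<in> x <# U"
  using coset_eq_iff by blast

lemma coset_subset: "U \<in> \<U> \<Longrightarrow> x \<in> N \<Longrightarrow> x <# U \<subseteq> N"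
  using subgroup_U(2) subgroup.m_closed[OF N] by (auto simp: l_coset_def)

text \<open>
  The connecting map \<open>N/V \<rightarrow> N/U\<close> sends the coset of \<open>x\<close> to the coset of \<open>x\<close>.
\<close>

lemma coset_mult:
  assumes "U \<in> \<U>" "V \<in> \<U>" "V \<subseteq> U" "x \<in> N"
  shows "(x <# V) <#> U = x <# U"
proof -
  note U = subgroup_U[OF assms(1)] and V = subgroup_U[OF assms(2)]
  have "V <#> U = U"
  proof
    show "V <#> U \<subseteq> U"
      using assms(3) subgroup.m_closed[OF U(1)] by (auto simp: set_mult_def)
    show "U \<subseteq> V <#> U"
    proof
      fix u assume "u \<in> U"
      then have "\<one> \<otimes> u \<in> V <#> U"
        using subgroup.one_closed[OF V(1)] unfolding set_mult_def by blast
      then show "u \<in> V <#> U"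
        using subgroup.mem_carrier[OF U(1) \<open>u \<in> U\<close>] by simp
    qed
  qed
  then show ?thesis
    using setmult_lcos_assoc[of V U x] U(1) V(1) N_carrier[OF assms(4)]
    by (simp add: subgroup.subset)
qed

lemma carrier_quotient:
  assumes "U \<in> \<U>"
  shows "carrier (G\<lparr>carrier := N\<rparr> Mod U) = (\<lambda>x. x <# U) ` N"
  using normal.coset_eq[OF normal[OF assms]]
  by (auto simp: FactGroup_def RCOSETS_def r_coset_def l_coset_def)

end

section \<open>The completion\<close>

context subgroup_topology
begin

abbreviation "X \<equiv> group_completion G N \<U>"
abbreviation "\<iota> \<equiv> coset_embed G \<U>"
abbreviation "P \<equiv> product_topology (\<lambda>U. discrete_topology ((\<lambda>x. x <# U) ` N)) \<U>"

lemma completion_eq: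
  "X = subtopology P {z. \<forall>U\<in>\<U>. \<forall>V\<in>\<U>. V \<subseteq> U \<longrightarrow> z V <#> U = z U}"
proof -
  have "product_topology (\<lambda>U. discrete_topology (carrier (G\<lparr>carrier := N\<rparr> Mod U))) \<U> = P"
    unfolding topology_eq openin_product_topology_alt
    by (simp add: carrier_quotient cong: conj_cong Collect_cong)
  then show ?thesis by (simp add: group_completion_def)
qed

lemma in_completionI:
  assumes "z \<in> extensional \<U>"
    and "\<And>U V. U \<in> \<U> \<Longrightarrow> V \<in> \<U> \<Longrightarrow> V \<subseteq> U \<Longrightarrow> \<exists>x\<in>N. z V = x <# V \<and> z U = x <# U"
  shows "z \<in> topspace X"
proof -
  have "z V <#> U = z U" if "U \<in> \<U>" "V \<in> \<U>" "V \<subseteq> U" for U V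
    using assms(2)[OF that] coset_mult[OF that] by auto
  moreover have "z U \<in> (\<lambda>x. x <# U) ` N" if "U \<in> \<U>" for U
    using assms(2)[OF that that] by auto
  ultimately show ?thesis
    using assms(1) by (auto simp: completion_eq PiE_iff)
qed

lemma completion_extensional: "z \<in> topspace X \<Longrightarrow> z \<in> extensional \<U>"
  by (auto simp: completion_eq PiE_iff)

text \<open>
  A point of the completion need not come from \<open>N\<close>, but it agrees with a point of \<open>N\<close> at
  any one coordinate \<open>V\<close>, and hence at all coarser ones. This is what reduces computations in the
  completion to computations with cosets of a single element.
\<close>

lemma completion_approx:
  assumes "z \<in> topspace X" "V \<in> \<U>"
  obtains x where "x \<in> N" "\<And>U. U \<in> \<U> \<Longrightarrow> V \<subseteq> U \<Longrightarrow> z U = x <# U"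
proof -
  obtain x where x: "x \<in> N" "z V = x <# V"
    using assms by (auto simp: completion_eq PiE_iff)
  have "z U = x <# U" if "U \<in> \<U>" "V \<subseteq> U" for U
    using assms that x coset_mult[OF that(1) assms(2) that(2) x(1)] by (force simp: completion_eq)
  then show ?thesis using that x(1) by blast
qed

lemma completion_coset:
  assumes "z \<in> topspace X" "U \<in> \<U>"
  obtains x where "x \<in> N" "z U = x <# U"
  using assms by (auto simp: completion_eq PiE_iff)

lemma completion_coordinate_mono:
  assumes "z \<in> topspace X" "w \<in> topspace X" "U \<in> \<U>" "V \<in> \<U>" "V \<subseteq> U" "z V = w V"
  shows "z U = w U"
proof -
  have "z V <#> U = z U" "w V <#> U = w U"
    using assms(1-5) by (simp_all add: completion_eq)
  then show ?thesis using assms(6) by simp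
qed

lemma embed_apply: "U \<in> \<U> \<Longrightarrow> \<iota> x U = x <# U"
  by (simp add: coset_embed_def)

lemma embed_in_completion: "x \<in> N \<Longrightarrow> \<iota> x \<in> topspace X"
  by (rule in_completionI) (auto simp: coset_embed_def)

lemma continuous_coordinate:
  "U \<in> \<U> \<Longrightarrow> continuous_map X (discrete_topology ((\<lambda>x. x <# U) ` N)) (\<lambda>z. z U)"
  unfolding completion_eq
  by (intro continuous_map_from_subtopology continuous_map_product_projection)

lemma openin_cylinder:
  assumes "U \<in> \<U>"
  shows "openin X {z \<in> topspace X. z U \<in> S}"
proof -
  have "openin X {z \<in> topspace X. z U \<in> S \<inter> (\<lambda>x. x <# U) ` N}"
    by (rule openin_continuous_map_preimage[OF continuous_coordinate[OF assms]]) simp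
  moreover have "{z \<in> topspace X. z U \<in> S \<inter> (\<lambda>x. x <# U) ` N} = {z \<in> topspace X. z U \<in> S}"
    using assms by (auto simp: completion_eq PiE_iff)
  ultimately show ?thesis by simp
qed

lemma closedin_cylinder:
  assumes "U \<in> \<U>"
  shows "closedin X {z \<in> topspace X. z U \<in> S}"
proof -
  have "topspace X - {z \<in> topspace X. z U \<in> S} = {z \<in> topspace X. z U \<in> - S}" by auto
  then show ?thesis
    using openin_cylinder[OF assms, of "- S"] by (auto simp: closedin_def)
qed

text \<open>
  A basic open set of the product restricts finitely many coordinates. Directedness supplies one
  \<open>V\<close> below all of them, and the coordinate at \<open>V\<close> determines the others; so single-coordinate
  conditions already form a base of the completion.
\<close>

lemma cylinder_base:
  assumes "openin X S" "z \<in> S"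
  obtains U where "U \<in> \<U>" "\<And>w. w \<in> topspace X \<Longrightarrow> w U = z U \<Longrightarrow> w \<in> S"
proof -
  have z: "z \<in> topspace X" using assms openin_subset by blast
  obtain T where T: "openin P T" "S = T \<inter> topspace X"
  proof -
    obtain T where T: "openin P T"
      "S = T \<inter> {z. \<forall>U\<in>\<U>. \<forall>V\<in>\<U>. V \<subseteq> U \<longrightarrow> z V <#> U = z U}"
      using assms(1) unfolding completion_eq openin_subtopology by blast
    then have "S = T \<inter> topspace X"
      using openin_subset[OF T(1)] by (subst completion_eq) auto
    then show ?thesis using that T(1) by blast
  qed
  then obtain B where B: "finite {U \<in> \<U>. B U \<noteq> (\<lambda>x. x <# U) ` N}" "z \<in> Pi\<^sub>E \<U> B" "Pi\<^sub>E \<U> B \<subseteq> T"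
    using assms(2) unfolding openin_product_topology_alt by force
  then obtain V where V: "V \<in> \<U>" "\<And>U. U \<in> \<U> \<Longrightarrow> B U \<noteq> (\<lambda>x. x <# U) ` N \<Longrightarrow> V \<subseteq> U"
    using directed_finite[OF B(1)] by auto
  have "w \<in> S" if w: "w \<in> topspace X" "w V = z V" for w
  proof -
    have "w U \<in> B U" if "U \<in> \<U>" for U
    proof (cases "B U = (\<lambda>x. x <# U) ` N")
      case True
      then show ?thesis using w(1) \<open>U \<in> \<U>\<close> by (auto simp: completion_eq PiE_iff)
    next
      case False
      have "w U = z U"
        by (rule completion_coordinate_mono[OF w(1) z that V(1) V(2)[OF that False] w(2)])
      then show ?thesis using B(2) that by (auto simp: PiE_iff)
    qed
    then show ?thesis
      using B(3) T(2) w(1) completion_extensional[OF w(1)] by (auto simp: PiE_iff subset_iff)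
  qed
  then show ?thesis using that V(1) by blast
qed

lemma dense_embed: "X closure_of (\<iota> ` N) = topspace X"
proof (intro equalityI closure_of_subset_topspace subsetI)
  fix z assume z: "z \<in> topspace X"
  have "\<exists>y\<in>\<iota> ` N. y \<in> T" if T: "z \<in> T" "openin X T" for T
  proof -
    obtain U where U: "U \<in> \<U>" "\<And>w. w \<in> topspace X \<Longrightarrow> w U = z U \<Longrightarrow> w \<in> T"
      using cylinder_base[OF T(2,1)] by blast
    obtain x where "x \<in> N" "z U = x <# U"
      using completion_coset[OF z U(1)] .
    then show ?thesis
      using U(2)[of "\<iota> x"] embed_in_completion[of x] embed_apply[OF U(1), of x] by auto
  qed
  then show "z \<in> X closure_of (\<iota> ` N)"
    using z by (auto simp: in_closure_of)
qed

lemma Hausdorff_completion: "Hausdorff_space X"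
  unfolding completion_eq
  by (intro Hausdorff_space_subtopology) (simp add: Hausdorff_space_product_topology)

text \<open>
  Each compatibility condition involves only two coordinates, with discrete values, so its failure
  is an open condition. Closedness is needed to get compactness from Tychonoff's theorem.
\<close>

lemma closedin_completion: "closedin P (topspace X)"
proof -
  have proj: "openin P {w \<in> topspace P. w U = C}" if "U \<in> \<U>" "C \<in> (\<lambda>x. x <# U) ` N" for U C
    using openin_continuous_map_preimage[OF continuous_map_product_projection[OF that(1),
        of "\<lambda>U. discrete_topology ((\<lambda>x. x <# U) ` N)"], of "{C}"] that(2)
    by simp
  have "\<exists>T. openin P T \<and> z \<in> T \<and> T \<subseteq> topspace P - topspace X"
    if z: "z \<in> topspace P - topspace X" for z
  proof -
    obtain U V where UV: "U \<in> \<U>" "V \<in> \<U>" "V \<subseteq> U" "z V <#> U \<noteq> z U"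
      using z by (auto simp: completion_eq)
    let ?T = "{w \<in> topspace P. w U = z U} \<inter> {w \<in> topspace P. w V = z V}"
    have "openin P ?T"
      using z UV(1,2) by (intro openin_Int proj) (auto simp: PiE_iff)
    moreover have "w \<notin> topspace X" if "w \<in> ?T" for w
    proof
      assume "w \<in> topspace X"
      then have "w V <#> U = w U" using UV(1-3) by (simp add: completion_eq)
      then show False using UV(4) that by simp
    qed
    moreover have "z \<in> ?T" using z by simp
    ultimately show ?thesis by (intro exI[of _ ?T]) blast
  qed
  then have "openin P (topspace P - topspace X)"
    by (subst openin_subopen) blast
  then show ?thesis
    by (auto simp: closedin_def completion_eq)
qed

lemma continuous_eq_on_completion:
  assumes "Hausdorff_space Y" "continuous_map X Y f" "continuous_map X Y h"
    and "\<And>x. x \<in> N \<Longrightarrow> f (\<iota> x) = h (\<iota> x)" and "z \<in> topspace X"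
  shows "f z = h z"
  using forall_in_closure_of_eq[OF _ assms(1-3), of z "\<iota> ` N"] assms(4,5) dense_embed by auto

section \<open>Extending uniformly continuous maps\<close>

text \<open>
  Uniform continuity says that the coset of \<open>\<phi> y\<close> modulo \<open>U\<close> depends only on the coset of \<open>y\<close>
  modulo some \<open>\<sigma> U\<close>. The extension is therefore forced: its \<open>U\<close>-coordinate at \<open>z\<close> is the coset
  modulo \<open>U\<close> of the image of any representative of \<open>z (\<sigma> U)\<close>. Each coordinate factors through
  a discrete quotient, which gives continuity.
\<close>

lemma uniformly_continuous_extension:
  assumes \<phi>: "\<And>y. y \<in> N \<Longrightarrow> \<phi> y \<in> N"
    and uc: "\<And>U. U \<in> \<U> \<Longrightarrow> \<exists>V\<in>\<U>. \<forall>y\<in>N. \<phi> ` (y <# V) \<subseteq> \<phi> y <# U"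
  obtains h where "continuous_map X X h" "\<And>y. y \<in> N \<Longrightarrow> h (\<iota> y) = \<iota> (\<phi> y)"
proof -
  obtain \<sigma> where \<sigma>: "\<And>U. U \<in> \<U> \<Longrightarrow> \<sigma> U \<in> \<U>"
    "\<And>U y. U \<in> \<U> \<Longrightarrow> y \<in> N \<Longrightarrow> \<phi> ` (y <# \<sigma> U) \<subseteq> \<phi> y <# U"
    using uc by metis
  define k where "k = (\<lambda>U C. \<phi> (SOME y. y \<in> C) <# U)"
  define h where "h = (\<lambda>z. \<lambda>U\<in>\<U>. k U (z (\<sigma> U)))"
  have k: "k U (y <# \<sigma> U) = \<phi> y <# U" if "U \<in> \<U>" "y \<in> N" for U y
  proof -
    have "(SOME y'. y' \<in> y <# \<sigma> U) \<in> y <# \<sigma> U"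
      using coset_self[OF \<sigma>(1)] that by (metis someI)
    then have "\<phi> (SOME y'. y' \<in> y <# \<sigma> U) \<in> \<phi> y <# U" 
      using \<sigma>(2)[OF that] by blast
    moreover from this have "\<phi> (SOME y'. y' \<in> y <# \<sigma> U) \<in> N"
      using coset_subset[OF that(1) \<phi>[OF that(2)]] by blast
    ultimately show ?thesis
      using coset_eq_iff[OF that(1) \<phi>[OF that(2)]] unfolding k_def by blast
  qed
  have h_in: "h z \<in> topspace X" if z: "z \<in> topspace X" for z
  proof (rule in_completionI)
    fix U V assume UV: "U \<in> \<U>" "V \<in> \<U>" "V \<subseteq> U"
    \<comment> \<open>The choice of \<open>\<sigma>\<close> need not be monotone, so a common refinement is needed to get one \<open>y\<close> for both coordinates.\<close>
    obtain W where W: "W \<in> \<U>" "W \<subseteq> \<sigma> U \<inter> \<sigma> V"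
      using directed \<sigma>(1) UV by meson
    then obtain y where "y \<in> N" "z (\<sigma> U) = y <# \<sigma> U" "z (\<sigma> V) = y <# \<sigma> V"
      using completion_approx[OF z W(1)] \<sigma>(1) UV by (metis le_infE)
    then show "\<exists>x\<in>N. h z V = x <# V \<and> h z U = x <# U"
      using k UV \<phi> by (auto simp: h_def)
  qed (simp add: h_def)
  have "continuous_map X P h"
    unfolding continuous_map_componentwise
  proof (intro conjI ballI)
    show "h ` topspace X \<subseteq> extensional \<U>" by (auto simp: h_def)
    fix U assume U: "U \<in> \<U>"
    have "continuous_map (discrete_topology ((\<lambda>x. x <# \<sigma> U) ` N)) (discrete_topology ((\<lambda>x. x <# U) ` N)) (k U)"
      using k[OF U] \<phi> by auto
    then have "continuous_map X (discrete_topology ((\<lambda>x. x <# U) ` N)) (k U \<circ> (\<lambda>z. z (\<sigma> U)))"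
      by (rule continuous_map_compose[OF continuous_coordinate[OF \<sigma>(1)[OF U]]])
    then show "continuous_map X (discrete_topology ((\<lambda>x. x <# U) ` N)) (\<lambda>z. h z U)"
      using U by (simp add: h_def o_def)
  qed
  then have "continuous_map X X h"
    using h_in by (subst (2) completion_eq)
      (auto simp: continuous_map_in_subtopology completion_eq)
  moreover have "h (\<iota> y) = \<iota> (\<phi> y)" if "y \<in> N" for y
    using k[OF _ that] \<sigma>(1) by (auto simp: h_def coset_embed_def fun_eq_iff)
  ultimately show ?thesis using that by blast
qed

text \<open>
  The extensions of \<open>\<phi>\<close> and of its inverse \<open>\<psi>\<close> are inverse to each other on the dense subgroup
  \<open>N\<close>, hence everywhere, since the completion is Hausdorff; uniqueness holds by the same
  principle. The conclusion has the form of the description that defines \<open>\<beta>_bar\<close>.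
\<close>

lemma ex1_homeomorphic_extension:
  assumes \<phi>: "\<And>y. y \<in> N \<Longrightarrow> \<phi> y \<in> N" "\<And>y. y \<in> N \<Longrightarrow> \<psi> (\<phi> y) = y"
      "\<And>U. U \<in> \<U> \<Longrightarrow> \<exists>V\<in>\<U>. \<forall>y\<in>N. \<phi> ` (y <# V) \<subseteq> \<phi> y <# U"
    and \<psi>: "\<And>y. y \<in> N \<Longrightarrow> \<psi> y \<in> N" "\<And>y. y \<in> N \<Longrightarrow> \<phi> (\<psi> y) = y"
      "\<And>U. U \<in> \<U> \<Longrightarrow> \<exists>V\<in>\<U>. \<forall>y\<in>N. \<psi> ` (y <# V) \<subseteq> \<psi> y <# U"
  shows "\<exists>!h. h \<in> extensional (topspace X) \<and> homeomorphic_map X X h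
    \<and> (\<forall>y\<in>N. h (\<iota> y) = \<iota> (\<phi> y))"
proof (rule ex_ex1I)
  obtain h where h: "continuous_map X X h" "\<And>y. y \<in> N \<Longrightarrow> h (\<iota> y) = \<iota> (\<phi> y)"
    using uniformly_continuous_extension[OF \<phi>(1,3)] by blast
  obtain k where k: "continuous_map X X k" "\<And>y. y \<in> N \<Longrightarrow> k (\<iota> y) = \<iota> (\<psi> y)"
    using uniformly_continuous_extension[OF \<psi>(1,3)] by blast
  have "(k \<circ> h) z = id z" "(h \<circ> k) z = id z" if "z \<in> topspace X" for z
    using h k \<phi>(1,2) \<psi>(1,2) that
      continuous_eq_on_completion[OF Hausdorff_completion continuous_map_compose[OF h(1) k(1)] continuous_map_id]
      continuous_eq_on_completion[OF Hausdorff_completion continuous_map_compose[OF k(1) h(1)] continuous_map_id]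
    by simp_all
  then have "homeomorphic_maps X X h k"
    using h(1) k(1) by (simp add: homeomorphic_maps_def)
  then have "homeomorphic_map X X h"
    using homeomorphic_maps_map by blast
  then have "homeomorphic_map X X (restrict h (topspace X))"
    by (rule homeomorphic_map_eq) simp
  then show "\<exists>h. h \<in> extensional (topspace X) \<and> homeomorphic_map X X h
      \<and> (\<forall>y\<in>N. h (\<iota> y) = \<iota> (\<phi> y))"
    using h(2) embed_in_completion by (intro exI[of _ "restrict h (topspace X)"]) auto
next
  fix h k
  assume h: "h \<in> extensional (topspace X) \<and> homeomorphic_map X X h \<and> (\<forall>y\<in>N. h (\<iota> y) = \<iota> (\<phi> y))"
    and k: "k \<in> extensional (topspace X) \<and> homeomorphic_map X X k \<and> (\<forall>y\<in>N. k (\<iota> y) = \<iota> (\<phi> y))"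
  show "h = k"
  proof (rule extensionalityI)
    show "h z = k z" if "z \<in> topspace X" for z
      by (rule continuous_eq_on_completion[OF Hausdorff_completion _ _ _ that])
        (use h k in \<open>auto intro: homeomorphic_imp_continuous_map\<close>)
  qed (use h k in auto)
qed

section \<open>Restriction of functions to the dense subgroup\<close>

abbreviation "\<rho> \<equiv> restriction G N \<U>"

lemma restriction_apply: "x \<in> N \<Longrightarrow> \<rho> f x = f (\<iota> x)"
  and restriction_outside: "x \<notin> N \<Longrightarrow> \<rho> f x = 0"
  by (simp_all add: restriction_def)

lemma restriction_in_linf: "f \<in> C0 X \<Longrightarrow> \<rho> f \<in> linf N"
  by (rule C0_bounded[of f X]) (auto simp: linf_def bounded_iff restriction_def)

lemma inj_restriction: "inj_on \<rho> (C0 X)"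
proof (rule inj_onI)
  fix f h assume f: "f \<in> C0 X" and h: "h \<in> C0 X" and eq: "\<rho> f = \<rho> h"
  have "f z = h z" for z
  proof (cases "z \<in> topspace X")
    case True
    show ?thesis
    proof (rule continuous_eq_on_completion[OF _ C0_continuous[OF f] C0_continuous[OF h] _ True])
      show "f (\<iota> x) = h (\<iota> x)" if "x \<in> N" for x
        using fun_cong[OF eq, of x] that by (simp add: restriction_apply)
    qed simp
  next
    case False
    then show ?thesis using C0_outside[OF f] C0_outside[OF h] by metis
  qed
  then show "f = h" ..
qed

text \<open>
  By density the restriction is isometric for the sup norm. Consequently a sequence in \<open>C0 X\<close> whose
  restrictions converge uniformly on \<open>N\<close> is uniformly Cauchy on the completion.
\<close>

lemma norm_le_on_completion:
  assumes "f \<in> C0 X" "\<And>x. x \<in> N \<Longrightarrow> norm (\<rho> f x) \<le> c" "z \<in> topspace X"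
  shows "norm (f z) \<le> c"
  using assms norm_le_on_closure[OF C0_continuous[OF assms(1)], of "\<iota> ` N" c z]
  by (auto simp: dense_embed restriction_apply)

lemma restriction_hom:
  "\<rho> (\<lambda>z. f z + h z) = (\<lambda>x. \<rho> f x + \<rho> h x)"
  "\<rho> (\<lambda>z. c * f z) = (\<lambda>x. c * \<rho> f x)"
  "\<rho> (\<lambda>z. f z * h z) = (\<lambda>x. \<rho> f x * \<rho> h x)"
  "\<rho> (\<lambda>z. cnj (f z)) = (\<lambda>x. cnj (\<rho> f x))"
  by (auto simp: restriction_def)

text \<open>
  Uniform approximations of \<open>f\<close> by restrictions come from a uniformly Cauchy sequence in \<open>C0 X\<close>,
  whose limit restricts to \<open>f\<close>.
\<close>

lemma restriction_image_closed:
  assumes f: "f \<in> linf N" and approx: "\<And>e. e > 0 \<Longrightarrow> \<exists>h\<in>C0 X. sup_norm N (\<lambda>x. f x - \<rho> h x) < e"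
  shows "f \<in> \<rho> ` C0 X"
proof -
  have "\<exists>h\<in>C0 X. \<forall>x\<in>N. norm (f x - \<rho> h x) < e" if "e > 0" for e
  proof -
    obtain h where h: "h \<in> C0 X" "sup_norm N (\<lambda>x. f x - \<rho> h x) < e"
      using approx[OF \<open>e > 0\<close>] by blast
    have "bounded ((\<lambda>x. f x - \<rho> h x) ` N)"
      using f restriction_in_linf[OF h(1)] by (intro bounded_minus_comp) (auto simp: linf_def)
    then show ?thesis
      using norm_less_if_sup_norm_less[OF _ h(2)] by (intro bexI[OF _ h(1)]) auto
  qed
  then have "\<forall>n. \<exists>h\<in>C0 X. \<forall>x\<in>N. norm (f x - \<rho> h x) < inverse (real (Suc n))"
    by simp
  then obtain F where F: "\<And>n. F n \<in> C0 X"
      "\<And>n x. x \<in> N \<Longrightarrow> norm (f x - \<rho> (F n) x) < inverse (real (Suc n))"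
    by metis
  have F_small: "\<exists>k. \<forall>n\<ge>k. \<forall>x\<in>N. norm (f x - \<rho> (F n) x) < e" if "e > 0" for e
  proof -
    obtain k where k: "inverse (real (Suc k)) < e"
      using reals_Archimedean[OF \<open>e > 0\<close>] by blast
    have "norm (f x - \<rho> (F n) x) < e" if "n \<ge> k" "x \<in> N" for n x
    proof -
      have "inverse (real (Suc n)) \<le> inverse (real (Suc k))" using that(1) by simp
      then show ?thesis using F(2)[OF that(2), of n] k by linarith
    qed
    then show ?thesis by blast
  qed
  obtain h where h: "h \<in> C0 X"
    "\<And>e. e > 0 \<Longrightarrow> \<forall>\<^sub>F n in sequentially. \<forall>z\<in>topspace X. dist (F n z) (h z) < e"
  proof (rule C0_uniform_limit[OF F(1)])
    fix e :: real assume "e > 0"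
    then obtain k where k: "\<And>n x. n \<ge> k \<Longrightarrow> x \<in> N \<Longrightarrow> norm (f x - \<rho> (F n) x) < e/4"
      using F_small[of "e/4"] by auto
    have "dist (F m z) (F n z) < e" if "k \<le> m" "k \<le> n" "z \<in> topspace X" for m n z
    proof -
      have "norm (\<rho> (\<lambda>z. F m z - F n z) x) \<le> e/2" if "x \<in> N" for x
        using k[OF \<open>k \<le> m\<close> that] k[OF \<open>k \<le> n\<close> that] that
          norm_triangle_ineq4[of "f x - \<rho> (F n) x" "f x - \<rho> (F m) x"]
        by (simp add: restriction_apply)
      then have "norm (F m z - F n z) \<le> e/2"
        using norm_le_on_completion[OF C0_diff[OF F(1) F(1)] _ that(3)] by blast
      then show ?thesis using \<open>e > 0\<close> by (simp add: dist_norm)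
    qed
    then show "\<exists>k. \<forall>m n x. k \<le> m \<longrightarrow> k \<le> n \<longrightarrow> x \<in> topspace X \<longrightarrow> dist (F m x) (F n x) < e"
      by blast
  qed blast
  have "f x = \<rho> h x" for x
  proof (cases "x \<in> N")
    case True
    have "dist (f x) (\<rho> h x) \<le> e" if "e > 0" for e
    proof -
      obtain k where k: "\<And>n. n \<ge> k \<Longrightarrow> norm (f x - \<rho> (F n) x) < e/2"
        using F_small[of "e/2"] \<open>e > 0\<close> True by auto
      obtain m where m: "\<And>n. n \<ge> m \<Longrightarrow> dist (F n (\<iota> x)) (h (\<iota> x)) < e/2"
        using h(2)[of "e/2"] \<open>e > 0\<close> embed_in_completion[OF True] 
        unfolding eventually_sequentially by auto
      show ?thesis
        using k[of "max k m"] m[of "max k m"] True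
          dist_triangle[of "f x" "\<rho> h x" "F (max k m) (\<iota> x)"]
        by (simp add: restriction_apply dist_norm)
    qed
    then show ?thesis by (metis dist_le_zero_iff field_le_epsilon add_0)
  qed (use f in \<open>simp add: linf_def restriction_outside\<close>)
  then show ?thesis using h(1) by blast
qed

lemma cstar_subalgebra_restriction_image: "cstar_subalgebra N (\<rho> ` C0 X)"
  unfolding cstar_subalgebra_def
proof (intro conjI ballI allI impI)
  show "\<rho> ` C0 X \<subseteq> linf N"
    using restriction_in_linf by blast
  show "(\<lambda>x. 0) \<in> \<rho> ` C0 X"
    by (rule image_eqI[OF _ C0_zero]) (simp add: restriction_def)
  show "(\<lambda>x. f x + h x) \<in> \<rho> ` C0 X" if "f \<in> \<rho> ` C0 X" "h \<in> \<rho> ` C0 X" for f h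
    using that by (auto simp flip: restriction_hom intro!: C0_add)
  show "(\<lambda>x. f x * h x) \<in> \<rho> ` C0 X" if "f \<in> \<rho> ` C0 X" "h \<in> \<rho> ` C0 X" for f h
    using that by (auto simp flip: restriction_hom intro!: C0_mult)
  show "(\<lambda>x. c * f x) \<in> \<rho> ` C0 X" if "f \<in> \<rho> ` C0 X" for c f
    using that by (auto simp flip: restriction_hom intro!: C0_scale)
  show "(\<lambda>x. cnj (f x)) \<in> \<rho> ` C0 X" if "f \<in> \<rho> ` C0 X" for f
    using that by (auto simp flip: restriction_hom intro!: C0_cnj)
  show "f \<in> \<rho> ` C0 X"
    if "f \<in> linf N" "\<forall>e>0. \<exists>h\<in>\<rho> ` C0 X. sup_norm N (\<lambda>x. f x - h x) < e" for f
    by (rule restriction_image_closed) (use that in auto)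
qed

text \<open>
  Why the cosets generate enough. Up to \<open>e\<close>, a function \<open>f\<close> in \<open>C0 X\<close> lives on a compact set
  \<open>L\<close>. Compactness gives a single \<open>V\<close> such that near \<open>L\<close> the function \<open>f\<close> varies little on each
  cylinder over a coset of \<open>V\<close>, and \<open>L\<close> meets only finitely many of these cylinders, because the
  \<open>V\<close>-coordinate is continuous with discrete values. Sampling \<open>f\<close> once in each of them gives a
  finite linear combination of coset indicators that is uniformly close to \<open>f\<close> on \<open>N\<close>.
\<close>

lemma restriction_in_cstar_subalgebra:
  assumes A: "cstar_subalgebra N A"
    and ind: "\<And>x U. x \<in> N \<Longrightarrow> U \<in> \<U> \<Longrightarrow> indicator (x <# U) \<in> A"
    and f: "f \<in> C0 X"
  shows "\<rho> f \<in> A"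
proof -
  have "\<exists>h\<in>A. sup_norm N (\<lambda>x. \<rho> f x - h x) < e" if e: "e > 0" for e
  proof -
    \<comment> \<open>Both sources of error, the oscillation over a coset and the part of \<open>f\<close> outside \<open>L\<close>, are at most \<open>2 * d\<close>, which is below \<open>e\<close>.\<close>
    define d where "d = e/4"
    have d: "d > 0" using e by (simp add: d_def)
    define L where "L = {z \<in> topspace X. d \<le> norm (f z)}"
    have L: "compactin X L" unfolding L_def by (rule C0_compact[OF f d])
    define osc where "osc = (\<lambda>z U. U \<in> \<U> \<and> (\<forall>w\<in>topspace X. w U = z U \<longrightarrow> dist (f w) (f z) < d))"
    have "\<exists>U. osc z U" if "z \<in> L" for z
    proof -
      have z: "z \<in> topspace X" using that by (simp add: L_def)
      have "openin X {w \<in> topspace X. f w \<in> ball (f z) d}"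
        by (rule openin_continuous_map_preimage[OF C0_continuous[OF f]]) simp
      then obtain U where "U \<in> \<U>"
        "\<And>w. w \<in> topspace X \<Longrightarrow> w U = z U \<Longrightarrow> w \<in> {w \<in> topspace X. f w \<in> ball (f z) d}"
        using cylinder_base[of _ z] z d by (metis (mono_tags, lifting) centre_in_ball mem_Collect_eq)
      then show ?thesis by (auto simp: osc_def dist_commute)
    qed
    then obtain U where U: "\<And>z. z \<in> L \<Longrightarrow> osc z (U z)" by metis
    have "\<exists>\<F>. finite \<F> \<and> \<F> \<subseteq> (\<lambda>z. {w \<in> topspace X. w (U z) \<in> {z (U z)}}) ` L \<and> L \<subseteq> \<Union>\<F>"
    proof (rule compactinD[OF L])
      fix T assume "T \<in> (\<lambda>z. {w \<in> topspace X. w (U z) \<in> {z (U z)}}) ` L"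
      then obtain z where "z \<in> L" "T = {w \<in> topspace X. w (U z) \<in> {z (U z)}}" by blast
      then show "openin X T"
        using U openin_cylinder[of "U z" "{z (U z)}"] unfolding osc_def by blast
    qed (auto simp: L_def)
    then obtain Z where Z: "finite Z" "Z \<subseteq> L"
        "L \<subseteq> \<Union> ((\<lambda>z. {w \<in> topspace X. w (U z) \<in> {z (U z)}}) ` Z)"
      by (metis (no_types, lifting) finite_subset_image)
    obtain V where V: "V \<in> \<U>" "\<And>z. z \<in> Z \<Longrightarrow> V \<subseteq> U z"
    proof -
      have "U ` Z \<subseteq> \<U>" using Z(2) U by (auto simp: osc_def)
      then show ?thesis using directed_finite[of "U ` Z"] Z(1) that by auto
    qed
    have osc_V: "dist (f w) (f w') < 2 * d"
      if w: "w \<in> L" "w' \<in> topspace X" "w' V = w V" for w w'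
    proof -
      obtain z where z: "z \<in> Z" "w (U z) = z (U z)" using Z(3) w(1) by blast
      have "osc z (U z)" using U z(1) Z(2) by blast
      have "w' (U z) = w (U z)"
        using w \<open>osc z (U z)\<close> V z(1)
        by (intro completion_coordinate_mono[of w' w "U z" V]) (auto simp: osc_def L_def)
      then have "dist (f w) (f z) < d" "dist (f w') (f z) < d"
        using \<open>osc z (U z)\<close> w z(2) by (auto simp: osc_def L_def)
      then show ?thesis using dist_triangle2[of "f w" "f w'" "f z"] by simp
    qed
    define F where "F = (\<lambda>z. z V) ` L"
    have "finite F"
      using image_compactin[OF L continuous_coordinate[OF V(1)]]
      by (simp add: F_def compactin_discrete_topology)
    obtain r where r: "\<And>C. C \<in> F \<Longrightarrow> r C \<in> L \<and> r C V = C"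
      using f_inv_into_f[of _ "\<lambda>z. z V" L] inv_into_into[of _ "\<lambda>z. z V" L] that unfolding F_def by blast
    \<comment> \<open>\<open>r C\<close> is the sample point in \<open>L\<close> over the coset \<open>C\<close>.\<close>
    define h where "h = (\<lambda>x. \<Sum>C\<in>F. f (r C) * indicator C x)"
    have "(\<lambda>x. \<Sum>C\<in>F'. f (r C) * indicator C x) \<in> A" if "F' \<subseteq> F" for F'
      using finite_subset[OF that \<open>finite F\<close>] that
    proof (induction F' rule: finite_induct)
      case empty
      then show ?case using A by (simp add: cstar_subalgebra_def)
    next
      case (insert C F')
      obtain x where "x \<in> N" "C = x <# V"
        using insert.prems r[of C] completion_coset[OF _ V(1), of "r C"] unfolding L_def by auto
      then have "indicator C \<in> A" using ind V(1) by blast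
      then have C: "(\<lambda>x. f (r C) * indicator C x) \<in> A"
        using A by (simp add: cstar_subalgebra_def)
      have F': "(\<lambda>x. \<Sum>C\<in>F'. f (r C) * indicator C x) \<in> A"
        using insert by blast
      have "(\<lambda>x. p x + q x) \<in> A" if "p \<in> A" "q \<in> A" for p q
        using A that by (simp add: cstar_subalgebra_def)
      from this[OF C F']
      have "(\<lambda>x. f (r C) * indicator C x + (\<Sum>C\<in>F'. f (r C) * indicator C x)) \<in> A" .
      then show ?case by (simp only: sum.insert[OF insert.hyps(1,2)])
    qed
    then have "h \<in> A" by (simp add: h_def)
    have "norm (\<rho> f x - h x) \<le> 2 * d" if x: "x \<in> N" for x
    proof -
      \<comment> \<open>Distinct cosets of \<open>V\<close> are disjoint, so at most one term of \<open>h x\<close> survives.\<close>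
      have only: "C = x <# V" if "C \<in> F" "x \<in> C" for C
      proof -
        have "r C \<in> topspace X" "r C V = C" using r[OF that(1)] by (auto simp: L_def)
        then obtain y where y: "y \<in> N" "C = y <# V"
          using completion_coset[OF _ V(1)] by metis
        then have "x \<in> y <# V" using that(2) by simp
        then show ?thesis using coset_eq_iff[OF V(1) y(1) x] y(2) by blast
      qed
      have "h x = (\<Sum>C\<in>F. if C = x <# V then f (r C) else 0)"
        unfolding h_def
      proof (rule sum.cong[OF refl])
        fix C assume "C \<in> F"
        then have "x \<in> C \<longleftrightarrow> C = x <# V"
          using only[of C] coset_self[OF V(1) x] by blast
        then show "f (r C) * indicator C x = (if C = x <# V then f (r C) else 0)"
          by (simp only: indicator_def if_True if_False split: if_split) simp
      qed
      also have "\<dots> = (if x <# V \<in> F then f (r (x <# V)) else 0)"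
        using \<open>finite F\<close> by simp
      finally have h: "h x = (if x <# V \<in> F then f (r (x <# V)) else 0)" .
      show ?thesis
      proof (cases "x <# V \<in> F")
        case True
        then have "dist (f (r (x <# V))) (f (\<iota> x)) < 2 * d"
          using osc_V[of "r (x <# V)" "\<iota> x"] r[OF True] embed_in_completion[OF x] embed_apply[OF V(1), of x]
          by metis
        then show ?thesis using True x h by (simp add: restriction_apply dist_norm norm_minus_commute)
      next
        case False
        have "\<iota> x V \<in> F" if "\<iota> x \<in> L"
          using imageI[OF that, of "\<lambda>z. z V"] by (simp only: F_def)
        then have "\<iota> x \<notin> L" using False embed_apply[OF V(1), of x] by metis
        then have "norm (f (\<iota> x)) < d" using embed_in_completion[OF x] by (auto simp: L_def)
        then show ?thesis using False x h d by (simp add: restriction_apply)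
      qed
    qed
    then have "sup_norm N (\<lambda>x. \<rho> f x - h x) \<le> 2 * d"
      unfolding sup_norm_def using subgroup.one_closed[OF N] by (intro cSUP_least) auto
    then show ?thesis using \<open>h \<in> A\<close> e by (intro bexI[of _ h]) (auto simp: d_def)
  qed
  then show ?thesis
    using A restriction_in_linf[OF f] by (simp add: cstar_subalgebra_def)
qed

end

section \<open>Finite quotients\<close>

text \<open>
  The set assumed finite is the set of left cosets of \<open>V\<close> in \<open>U\<close>, that is, the quotient \<open>U/V\<close>.
\<close>

locale finite_quotient_topology = subgroup_topology +
  assumes fin: "\<And>U V. U \<in> \<U> \<Longrightarrow> V \<in> \<U> \<Longrightarrow> V \<subseteq> U \<Longrightarrow> finite ((\<lambda>u. u <# V) ` U)"
begin

text \<open>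
  Inside one coset of \<open>U\<close> every other coordinate \<open>W\<close> takes finitely many values: it is
  determined by the coordinate at some \<open>V \<subseteq> U \<inter> W\<close>, for which there are \<open>\<bar>U/V\<bar>\<close> possibilities. So the
  cylinder is a closed subset of a product of finite sets.
\<close>

lemma compactin_cylinder:
  assumes U: "U \<in> \<U>"
  shows "compactin X {z \<in> topspace X. z U \<in> {x <# U}}" (is "compactin X ?K")
proof (cases "?K = {}")
  case True
  then show ?thesis by (simp only: compactin_empty)
next
  case False
  then obtain z where z: "z \<in> topspace X" "z U = x <# U" by auto
  obtain c where c: "c \<in> N" "x <# U = c <# U"
    using completion_coset[OF z(1) U] z(2) by metis
  define F where "F = (\<lambda>W. (\<lambda>z. z W) ` ?K)"
  have "finite (F W)" if W: "W \<in> \<U>" for W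
  proof -
    obtain V where V: "V \<in> \<U>" "V \<subseteq> U" "V \<subseteq> W" using directed[OF U W] by auto
    have "z W \<in> (\<lambda>D. (c <# D) <#> W) ` (\<lambda>u. u <# V) ` U" if z: "z \<in> ?K" for z
    proof -
      obtain y where y: "y \<in> N" "\<And>U. U \<in> \<U> \<Longrightarrow> V \<subseteq> U \<Longrightarrow> z U = y <# U"
        using completion_approx[OF _ V(1), of z] z by blast
      have "c <# U = y <# U" using y(2)[OF U V(2)] z c(2) by simp
      then have "y \<in> c <# U" using coset_eq_iff[OF U c(1) y(1)] by blast
      then obtain u where u: "u \<in> U" "y = c \<otimes> u" by (auto simp: l_coset_def)
      have "c <# (u <# V) = y <# V"
        using u c(1) subgroup.mem_carrier[OF subgroup_U(1)[OF U]] N_carrier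
          subgroup.subset[OF subgroup_U(1)[OF V(1)]]
        by (simp add: lcos_m_assoc)
      then have "z W = (c <# (u <# V)) <#> W"
        using coset_mult[OF W V(1) V(3) y(1)] y(2)[OF W V(3)] by simp
      then show ?thesis using u(1) by blast
    qed
    then have "F W \<subseteq> (\<lambda>D. (c <# D) <#> W) ` (\<lambda>u. u <# V) ` U" by (auto simp: F_def)
    then show ?thesis using fin[OF U V(1,2)] finite_subset by blast
  qed
  moreover have "F W \<subseteq> (\<lambda>x. x <# W) ` N" if "W \<in> \<U>" for W
    using that by (auto simp: F_def completion_eq PiE_iff)
  ultimately have "compactin P (Pi\<^sub>E \<U> F)"
    by (auto simp: compactin_PiE compactin_discrete_topology)
  moreover have "?K \<subseteq> Pi\<^sub>E \<U> F"
  proof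
    fix z assume "z \<in> ?K"
    then show "z \<in> Pi\<^sub>E \<U> F"
      unfolding F_def PiE_iff using completion_extensional[of z] by blast
  qed
  moreover have "closedin P ?K"
  proof (rule closedin_trans_full[OF _ closedin_completion])
    have "subtopology P (topspace X) = X"
      unfolding completion_eq by (simp only: topspace_subtopology subtopology_restrict)
    then show "closedin (subtopology P (topspace X)) ?K"
      using closedin_cylinder[OF U, of "{x <# U}"] by (simp only:)
  qed
  ultimately have "compactin P ?K" by (rule closed_compactin)
  then show ?thesis
    by (subst completion_eq) (auto simp: compactin_subtopology completion_eq)
qed

text \<open>
  One inclusion is the approximation of functions in \<open>C0 X\<close> by combinations of coset indicators.
  For the other, the indicator of \<open>x <# U\<close> is the restriction of the indicator of a cylinder, which
  is compact and open, and the image of \<open>\<rho>\<close> is itself a \<open>C\<^sup>*\<close>-subalgebra.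
\<close>

lemma restriction_image: "\<rho> ` C0 X = coset_algebra G N \<U>"
proof
  have "\<rho> f \<in> A" if "f \<in> C0 X" "cstar_subalgebra N A"
    "{indicator (x <# U) |x U. x \<in> N \<and> U \<in> \<U>} \<subseteq> A" for f A
    using restriction_in_cstar_subalgebra[OF that(2) _ that(1)] that(3) by blast
  then show "\<rho> ` C0 X \<subseteq> coset_algebra G N \<U>"
    by (auto simp: coset_algebra_def cstar_generated_def)
  have "indicator (x <# U) \<in> \<rho> ` C0 X" if "x \<in> N" "U \<in> \<U>" for x U
  proof -
    let ?K = "{z \<in> topspace X. z U \<in> {x <# U}}"
    have "indicator ?K \<in> C0 X"
      using that by (intro C0_indicator openin_cylinder closedin_cylinder compactin_cylinder)
    moreover have "indicator (x <# U) = \<rho> (indicator ?K)"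
    proof
      fix y 
      show "indicator (x <# U) y = \<rho> (indicator ?K) y"
        using coset_subset[OF that(2,1)] coset_eq_iff[OF that(2,1), of y] that(2)
        by (auto simp: restriction_def indicator_def embed_in_completion embed_apply)
    qed
    ultimately show ?thesis by blast
  qed
  then show "coset_algebra G N \<U> \<subseteq> \<rho> ` C0 X"
    using cstar_subalgebra_restriction_image
    unfolding coset_algebra_def cstar_generated_def by blast
qed

lemma star_isomorphism_restriction:
  "star_isomorphism (C0 X) (coset_algebra G N \<U>) \<rho>"
  by (simp add: star_isomorphism_def bij_betw_def inj_restriction restriction_image restriction_hom)

end

section \<open>The action of a semidirect product on its normal factor\<close>

locale semidirect_product = group G for G (structure) +
  fixes N H :: "'a set"
  assumes N: "N \<lhd> G" and H: "subgroup H G"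
    and trivial_Int: "N \<inter> H = {\<one>}" and product: "N <#> H = carrier G"
begin

lemma N_mem: "x \<in> N \<Longrightarrow> x \<in> carrier G"
  using normal_imp_subgroup[OF N] subgroup.mem_carrier by metis

lemma H_mem: "a \<in> H \<Longrightarrow> a \<in> carrier G"
  using subgroup.mem_carrier[OF H] .

lemma cancel:
  assumes "a \<in> carrier G" "z \<in> carrier G"
  shows "inv a \<otimes> (a \<otimes> z) = z" "a \<otimes> (inv a \<otimes> z) = z"
  using assms by (simp_all flip: m_assoc)

lemma decomposition_unique:
  assumes "x \<in> N" "a \<in> H" "y \<in> N" "b \<in> H" and eq: "x \<otimes> a = y \<otimes> b"
  shows "x = y" "a = b"
proof -
  have c: "x \<in> carrier G" "a \<in> carrier G" "y \<in> carrier G" "b \<in> carrier G"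
    using assms(1-4) N_mem H_mem by auto
  have "inv y \<otimes> x = b \<otimes> inv a"
    using eq c by (metis inv_closed inv_solve_left inv_solve_right m_assoc m_closed)
  moreover have "inv y \<otimes> x \<in> N"
    using assms normal_imp_subgroup[OF N] by (simp add: subgroup.m_closed subgroup.m_inv_closed)
  moreover have "b \<otimes> inv a \<in> H"
    using assms H by (simp add: subgroup.m_closed subgroup.m_inv_closed)
  ultimately have "inv y \<otimes> x = \<one>" "b \<otimes> inv a = \<one>"
    using trivial_Int by auto
  then show "x = y" "a = b"
    using c by (metis inv_equality inv_inv inv_closed, metis inv_equality inv_inv inv_closed)
qed

lemma decomposition:
  assumes "g \<in> carrier G"
  obtains x a where "x \<in> N" "a \<in> H" "g = x \<otimes> a"
  using assms unfolding product[symmetric] set_mult_def by blast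

lemma \<beta>_eq:
  assumes "x \<in> N" "a \<in> H"
  shows "\<beta> G N H (x \<otimes> a) y = x \<otimes> a \<otimes> y \<otimes> inv a"
  unfolding \<beta>_def
  using assms decomposition_unique by (intro the_equality) blast+

lemma \<beta>_closed:
  assumes "g \<in> carrier G" "y \<in> N"
  shows "\<beta> G N H g y \<in> N"
proof -
  obtain x a where g: "x \<in> N" "a \<in> H" "g = x \<otimes> a" using decomposition[OF assms(1)] .
  have "x \<otimes> (a \<otimes> y \<otimes> inv a) \<in> N"
    using g assms(2) H_mem normal.inv_op_closed2[OF N] normal_imp_subgroup[OF N]
    by (simp add: subgroup.m_closed)
  then show ?thesis
    using g assms(2) by (simp add: \<beta>_eq m_assoc N_mem H_mem)
qed

lemma \<beta>_inverse:
  assumes "g \<in> carrier G" "y \<in> N"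
  shows "\<beta> G N H (inv g) (\<beta> G N H g y) = y"
proof -
  obtain x a where g: "x \<in> N" "a \<in> H" "g = x \<otimes> a" using decomposition[OF assms(1)] .
  have mem: "x \<in> carrier G" "a \<in> carrier G" "y \<in> carrier G"
    using g assms(2) N_mem H_mem by auto
  \<comment> \<open>The decomposition of \<open>inv g\<close> as an element of \<open>N\<close> times an element of \<open>H\<close>.\<close>
  have inv_g: "inv g = (inv a \<otimes> inv x \<otimes> a) \<otimes> inv a"
    using g mem by (simp add: inv_mult_group m_assoc)
  have "inv a \<otimes> inv x \<otimes> a \<in> N"
    using normal.inv_op_closed1[OF N mem(2)] g(1) normal_imp_subgroup[OF N]
    by (simp add: subgroup.m_inv_closed)
  then have "\<beta> G N H (inv g) w = inv g \<otimes> w \<otimes> a" for w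
    using \<beta>_eq[of "inv a \<otimes> inv x \<otimes> a" "inv a"] g(2) mem(2) subgroup.m_inv_closed[OF H]
    by (simp flip: inv_g)
  then show ?thesis
    using g mem assms(1) by (simp add: \<beta>_eq inv_mult_group m_assoc cancel)
qed

lemma \<beta>_inverse':
  assumes "g \<in> carrier G" "y \<in> N"
  shows "\<beta> G N H g (\<beta> G N H (inv g) y) = y"
  using \<beta>_inverse[of "inv g"] assms by simp

text \<open>
  For \<open>g = x a\<close>, the map \<open>\<beta> G N H g\<close> is conjugation by \<open>a\<close> followed by left translation by \<open>x\<close>. It
  carries \<open>y V\<close> into the coset of \<open>\<beta> G N H g y\<close> modulo the conjugate of \<open>V\<close> by \<open>a\<close>, and conjugation by
  \<open>inv a\<close> permutes \<open>conjugates G H M\<close>.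
\<close>

lemma \<beta>_uniformly_continuous:
  assumes g: "g \<in> carrier G" and M: "M \<subseteq> N" and U: "U \<in> conjugates G H M"
  shows "\<exists>V\<in>conjugates G H M. \<forall>y\<in>N. \<beta> G N H g ` (y <# V) \<subseteq> \<beta> G N H g y <# U"
proof -
  obtain x a where xa: "x \<in> N" "a \<in> H" "g = x \<otimes> a" using decomposition[OF g] .
  obtain c where c: "c \<in> H" "U = (\<lambda>m. c \<otimes> m \<otimes> inv c) ` M"
    using U by (auto simp: conjugates_def)
  define b where "b = inv a \<otimes> c"
  define V where "V = (\<lambda>m. b \<otimes> m \<otimes> inv b) ` M"
  have b: "b \<in> H"
    using xa(2) c(1) H by (simp add: b_def subgroup.m_closed subgroup.m_inv_closed)
  have mem: "x \<in> carrier G" "a \<in> carrier G" "c \<in> carrier G" "b \<in> carrier G"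
    using xa c b N_mem H_mem by auto
  have "\<beta> G N H g (y \<otimes> v) \<in> \<beta> G N H g y <# U" if y: "y \<in> N" and v: "v \<in> V" for y v
  proof -
    obtain m where m: "m \<in> M" "v = b \<otimes> m \<otimes> inv b" using v by (auto simp: V_def)
    have mc: "m \<in> carrier G" "y \<in> carrier G" using m(1) M y N_mem by auto
    have "\<beta> G N H g (y \<otimes> v) = \<beta> G N H g y \<otimes> (c \<otimes> m \<otimes> inv c)"
      using xa mem mc m(2) by (simp add: \<beta>_eq b_def inv_mult_group m_assoc cancel)
    then show ?thesis using m(1) c(2) by (auto simp: l_coset_def)
  qed
  moreover have "V \<in> conjugates G H M" using b by (auto simp: conjugates_def V_def)
  ultimately show ?thesis by (intro bexI[of _ V]) (auto simp: l_coset_def)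
qed

text \<open>
  Conjugation by an element of \<open>H\<close> is an automorphism of \<open>N\<close>, so it preserves normality in \<open>N\<close>:
  for \<open>x\<close> in \<open>N\<close>, conjugating \<open>c m c\<inverse>\<close> by \<open>x\<close> amounts to conjugating \<open>m\<close> by \<open>c\<inverse> x c\<close>, again an
  element of \<open>N\<close>.
\<close>

lemma conjugate_normal:
  assumes M: "M \<lhd> G\<lparr>carrier := N\<rparr>" and U: "U \<in> conjugates G H M"
  shows "U \<lhd> G\<lparr>carrier := N\<rparr>"
proof -
  have N': "subgroup N G" by (rule normal_imp_subgroup[OF N])
  interpret K: group "G\<lparr>carrier := N\<rparr>" by (rule subgroup_imp_group[OF N'])
  have inv_K: "inv\<^bsub>G\<lparr>carrier := N\<rparr>\<^esub> x = inv x" if "x \<in> N" for x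
    using m_inv_consistent[OF N' that] .
  have M_sub: "subgroup M (G\<lparr>carrier := N\<rparr>)" by (rule normal_imp_subgroup[OF M])
  then have M_G: "subgroup M G" by (rule incl_subgroup[OF N'])
  have MN: "M \<subseteq> N" using subgroup.subset[OF M_sub] by simp
  have M_conj: "y \<otimes> m \<otimes> inv y \<in> M" if "y \<in> N" "m \<in> M" for y m
    using normal.inv_op_closed2[OF M, of y m] that inv_K by simp
  obtain c where c: "c \<in> H" and U_eq: "U = (\<lambda>m. c \<otimes> m \<otimes> inv c) ` M"
    using U by (auto simp: conjugates_def)
  have cG: "c \<in> carrier G" using c H_mem by simp
  have mem: "m \<in> carrier G" if "m \<in> M" for m using that MN N_mem by auto
  have UN: "U \<subseteq> N"
    using normal.inv_op_closed2[OF N cG] MN by (auto simp: U_eq)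
  have "subgroup U (G\<lparr>carrier := N\<rparr>)"
  proof (rule K.subgroupI)
    show "U \<subseteq> carrier (G\<lparr>carrier := N\<rparr>)" using UN by simp
    show "U \<noteq> {}" using subgroup.one_closed[OF M_G] by (auto simp: U_eq)
    fix u assume u: "u \<in> U"
    then obtain m where m: "m \<in> M" "u = c \<otimes> m \<otimes> inv c" by (auto simp: U_eq)
    have "inv u = c \<otimes> inv m \<otimes> inv c"
      using m mem[OF m(1)] cG by (simp add: inv_mult_group m_assoc)
    then show "inv\<^bsub>G\<lparr>carrier := N\<rparr>\<^esub> u \<in> U"
      using inv_K u UN subgroup.m_inv_closed[OF M_G m(1)] by (auto simp: U_eq)
    fix v assume "v \<in> U"
    then obtain n where n: "n \<in> M" "v = c \<otimes> n \<otimes> inv c" by (auto simp: U_eq)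
    have "u \<otimes> v = c \<otimes> (m \<otimes> n) \<otimes> inv c"
      using m n mem[OF m(1)] mem[OF n(1)] cG by (simp add: m_assoc cancel)
    then show "u \<otimes>\<^bsub>G\<lparr>carrier := N\<rparr>\<^esub> v \<in> U"
      using subgroup.m_closed[OF M_G m(1) n(1)] by (auto simp: U_eq)
  qed
  moreover have "x \<otimes> u \<otimes> inv x \<in> U" if x: "x \<in> N" and u: "u \<in> U" for x u
  proof -
    obtain m where m: "m \<in> M" "u = c \<otimes> m \<otimes> inv c" using u by (auto simp: U_eq)
    define y where "y = inv c \<otimes> x \<otimes> c"
    have y: "y \<in> N" using normal.inv_op_closed1[OF N cG x] by (simp add: y_def)
    have "x \<otimes> u \<otimes> inv x = c \<otimes> (y \<otimes> m \<otimes> inv y) \<otimes> inv c"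
      using m mem[OF m(1)] cG N_mem[OF x] by (simp add: y_def inv_mult_group m_assoc cancel)
    then show ?thesis using M_conj[OF y m(1)] by (auto simp: U_eq)
  qed
  ultimately show ?thesis
    by (simp add: K.normal_inv_iff inv_K)
qed

end

text \<open>
  The isomorphism is an instance of the result for directed families of normal subgroups.
  Equivariance needs only that \<open>\<beta>_bar\<close> extends \<open>\<beta>\<close> along the embedding of \<open>N\<close>: restricting a
  function and then translating it evaluates it at the same points as the opposite order.
\<close>

theorem proposition3p2:
  fixes G :: "('a, 'b) monoid_scheme" and N H M :: "'a set" and \<U> :: "'a set set"
  assumes "group G"
    and "N \<lhd> G" and "subgroup H G"
    and "N \<inter> H = {\<one>\<^bsub>G\<^esub>}" and "N <#>\<^bsub>G\<^esub> H = carrier G"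
    and "M \<lhd> G\<lparr>carrier := N\<rparr>" and "M \<noteq> {\<one>\<^bsub>G\<^esub>}"
    and "\<U> = conjugates G H M"
    and filter_base: "\<forall>U\<in>\<U>. \<forall>V\<in>\<U>. \<exists>W\<in>\<U>. W \<subseteq> U \<inter> V"
    and separating: "\<Inter>\<U> = {\<one>\<^bsub>G\<^esub>}"
    and finite_quotients:
      "\<forall>U\<in>\<U>. \<forall>V\<in>\<U>. V \<subseteq> U \<longrightarrow> finite (carrier (G\<lparr>carrier := U\<rparr> Mod V))"
  shows "star_isomorphism (C0 (group_completion G N \<U>)) (coset_algebra G N \<U>) (restriction G N \<U>)
       \<and> (\<forall>g\<in>carrier G. \<forall>f\<in>C0 (group_completion G N \<U>).
            restriction G N \<U> (\<alpha>_bar G N H \<U> g f) = \<alpha> G N H g (restriction G N \<U> f))"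
proof -
  interpret semidirect_product G N H
    using assms(1-5) by (simp add: semidirect_product_def semidirect_product_axioms_def)
  note \<U> = assms(8)
  have normal_U: "U \<lhd> G\<lparr>carrier := N\<rparr>" if "U \<in> \<U>" for U
    using conjugate_normal[OF assms(6)] that \<U> by simp
  interpret T: subgroup_topology G N \<U>
  proof (intro subgroup_topology.intro subgroup_topology_axioms.intro)
    show "subgroup N G" by (rule normal_imp_subgroup[OF assms(2)])
    show "\<U> \<noteq> {}" using subgroup.one_closed[OF assms(3)] by (auto simp: \<U> conjugates_def)
  qed (use is_group normal_U filter_base in auto)
  interpret finite_quotient_topology G N \<U>
  proof
    fix U V assume UV: "U \<in> \<U>" "V \<in> \<U>" "V \<subseteq> U"
    have "V #>\<^bsub>G\<^esub> u = u <#\<^bsub>G\<^esub> V" if "u \<in> U" for u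
    proof -
      have "u \<in> N" using T.subgroup_U(2)[OF UV(1)] that by blast
      then show ?thesis
        using normal.coset_eq[OF normal_U[OF UV(2)]] by (simp add: r_coset_def l_coset_def)
    qed
    then have "(\<lambda>u. u <#\<^bsub>G\<^esub> V) ` U = carrier (G\<lparr>carrier := U\<rparr> Mod V)"
      by (auto simp: FactGroup_def RCOSETS_def r_coset_def)
    then show "finite ((\<lambda>u. u <#\<^bsub>G\<^esub> V) ` U)" using finite_quotients UV by simp
  qed
  have M: "M \<subseteq> N"
    using subgroup.subset[OF normal_imp_subgroup[OF assms(6)]] by simp
  have \<beta>_bar: "\<beta>_bar G N H \<U> g (T.\<iota> y) = T.\<iota> (\<beta> G N H g y)"
    if g: "g \<in> carrier G" and y: "y \<in> N" for g y
  proof -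
    have "\<exists>!h. h \<in> extensional (topspace T.X) \<and> homeomorphic_map T.X T.X h
        \<and> (\<forall>y\<in>N. h (T.\<iota> y) = T.\<iota> (\<beta> G N H g y))"
      using \<beta>_uniformly_continuous[OF _ M, folded \<U>] g
      by (intro T.ex1_homeomorphic_extension[of _ "\<beta> G N H (inv\<^bsub>G\<^esub> g)"])
        (simp_all add: \<beta>_closed \<beta>_inverse \<beta>_inverse')
    from theI'[OF this, folded \<beta>_bar_def] show ?thesis using y by blast
  qed
  have "T.\<rho> (\<alpha>_bar G N H \<U> g f) = \<alpha> G N H g (T.\<rho> f)" if "g \<in> carrier G" for g f
    using that \<beta>_bar[of "inv\<^bsub>G\<^esub> g"] \<beta>_closed[of "inv\<^bsub>G\<^esub> g"]
    by (intro ext) (simp add: restriction_def \<alpha>_bar_def \<alpha>_def T.embed_in_completion)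
  then show ?thesis using star_isomorphism_restriction by blast
qed

end
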